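(* Let $G=G(t,\tilde k,\{k_i\}_{i=1}^m)$ be a partially completed star-graph with center $0$ and non-center vertices $[n]=\{1,\dots,n\}$, having $t$ tadpoles, $\tilde k$ isolated triangles and $m$ bands of adjacent triangles with $k_1,\dots,k_m$ triangles respectively, and let $k=\tilde k+\sum_{i=1}^m k_i$ be its total number of triangles. Then the Triangle Friendship Paradox holds for $G$, i.e. $\Delta^T_{[n+1]}\ge 0$, and the triangle friendship-bias (TFB) of $G$ is given by $$\Delta^T_{[n+1]}=\frac{1}{n+1}\Big(\mathrm{C}+\sum_{i=1}^m \mathrm{AT}_k(k_i)+\tilde k\,\mathrm{IT}_k+t\,\mathrm{TP}_k\Big),$$ where - $\mathrm{C}=\frac{2k}{n}-k$ is the triangle friendship-bias of the center $0$, - $\mathrm{AT}_k(k_i)=\frac{k(k_i+2)}{3}-\frac{2k_i}{3}$ is the sum of the triangle friendship-biases of the non-center vertices in the band of $k_i$ adjacent triangles, - $\mathrm{IT}_k=k-1$ is the sum of the triangle friendship-biases of the non-center vertices in each of the $\tilde k$ isolated triangles, - $\mathrm{TP}_k=k$ is the triangle friendship-bias of the non-center vertex of a tadpole.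
   Context: Triangle friendship-bias. For a finite undirected graph $G$ with vertex set $V$, adjacency matrix $(A_{uv})_{u,v\in V}$, degrees $d_v=\sum_{u}A_{vu}$, and $t_v$ the number of triangles containing $v$, the triangle friendship-bias of the vertex $v$ is $$\Delta^T_v=\Big[\frac1{d_v}\sum_{u\in V}A_{vu}t_u-t_v\Big]\mathbf 1_{\{d_v\ne0\}}.$$ The triangle friendship-bias (TFB) of $G$ is the average over all vertices, $\Delta^T_{[|V|]}=\frac1{|V|}\sum_{v\in V}\Delta^T_v$. The Triangle Friendship Paradox (TFP) holds for $G$ when $\Delta^T_{[|V|]}\ge0$. Partially completed star-graphs. Let $n>1$. A partially completed star-graph is a graph with vertex set $\{0\}\cup[n]$, $[n]=\{1,\dots,n\}$, and edge set $\{\{0,i\}: i\in[n]\}\cup W$, where $\varnothing\ne W\subsetneq\{\{i,i+1\}: i\in[n]\}$ with the cyclic convention $n+1=1$. By convention the triangle on $\{0,1,2\}$ (with edges $\{0,1\},\{0,2\},\{1,2\}$) is also a partially completed star-graph. Vertex $0$ is the center. A tadpole is an edge $\{0,i\}$ such that $i\in[n]$ is adjacent only to $0$. Consider the connected components of the graph $([n],W)$ (each is a path): a component with exactly one edge gives (together with $0$) an isolated triangle; a component with $r\ge2$ edges gives a band of $r$ adjacent triangles, whose non-center vertices are the $r+1$ vertices of the component. $G(t,\tilde k,\{k_i\}_{i=1}^m)$ denotes such a graph with $t$ tadpoles, $\tilde k$ isolated triangles and $m$ bands with $k_1,\dots,k_m$ triangles (each of $t,\tilde k,m$ may be $0$).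 Thus $n=2\tilde k+\sum_{i=1}^m(k_i+1)+t$, and the graph has $n+1$ vertices. *)

theory Defs
  imports Complex_Main
begin

definition fin_graph :: "'a set \<Rightarrow> 'a set set \<Rightarrow> bool" where
  "fin_graph V E \<longleftrightarrow> finite V \<and> (\<forall>e\<in>E. e \<subseteq> V \<and> card e = 2)"

definition adjacency :: "'a set set \<Rightarrow> 'a \<Rightarrow> 'a \<Rightarrow> nat" where
  "adjacency E u v = of_bool ({u, v} \<in> E)"

definition degree :: "'a set \<Rightarrow> 'a set set \<Rightarrow> 'a \<Rightarrow> nat" where
  "degree V E v = (\<Sum>u\<in>V. adjacency E v u)"

definition triangles :: "'a set \<Rightarrow> 'a set set \<Rightarrow> 'a set set" where
  "triangles V E =
     {T. T \<subseteq> V \<and> card T = 3 \<and> (\<forall>u\<in>T. \<forall>v\<in>T. u \<noteq> v \<longrightarrow> {u, v} \<in> E)}"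

definition triangles_at :: "'a set \<Rightarrow> 'a set set \<Rightarrow> 'a \<Rightarrow> nat" where
  "triangles_at V E v = card {T \<in> triangles V E. v \<in> T}"

definition vertex_TFB :: "'a set \<Rightarrow> 'a set set \<Rightarrow> 'a \<Rightarrow> real" where
  "vertex_TFB V E v =
     (1 / real (degree V E v) * (\<Sum>u\<in>V. real (adjacency E v u) * real (triangles_at V E u))
        - real (triangles_at V E v)) * of_bool (degree V E v \<noteq> 0)"

definition TFB :: "'a set \<Rightarrow> 'a set set \<Rightarrow> real" where
  "TFB V E = 1 / real (card V) * (\<Sum>v\<in>V. vertex_TFB V E v)"

definition TFP_holds :: "'a set \<Rightarrow> 'a set set \<Rightarrow> bool" where
  "TFP_holds V E \<longleftrightarrow> TFB V E \<ge> 0"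

definition components :: "'a set \<Rightarrow> 'a set set \<Rightarrow> 'a set set" where
  "components V E = V // {(u, v). u \<in> V \<and> v \<in> V \<and> (u, v) \<in> {(x, y). {x, y} \<in> E}\<^sup>*}"

definition edges_within :: "'a set set \<Rightarrow> 'a set \<Rightarrow> 'a set set" where
  "edges_within E S = {e \<in> E. e \<subseteq> S}"

definition rim_edges :: "nat \<Rightarrow> nat set set" where
  "rim_edges n = {{i, i mod n + 1} | i. i \<in> {1..n}}"

text \<open>
  The pair \<open>(n, W)\<close> represents the graph with center \<open>0\<close>, spokes to \<open>1, ..., n\<close> and
  rim edges \<open>W\<close>. For \<open>n = 2\<close> there is only one rim edge, so the first disjunct below is never
  satisfied and the second one adds the triangle on \<open>{0, 1, 2}\<close>.
\<close>

definition partially_completed_star :: "nat \<Rightarrow> nat set set \<Rightarrow> bool" where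
  "partially_completed_star n W \<longleftrightarrow>
     n > 1 \<and> (W \<noteq> {} \<and> W \<subset> rim_edges n \<or> n = 2 \<and> W = {{1, 2}})"

definition star_vertices :: "nat \<Rightarrow> nat set" where
  "star_vertices n = {0} \<union> {1..n}"

definition star_edges :: "nat \<Rightarrow> nat set set \<Rightarrow> nat set set" where
  "star_edges n W = {{0, i} | i. i \<in> {1..n}} \<union> W"

definition tadpoles :: "nat \<Rightarrow> nat set set \<Rightarrow> nat set set" where
  "tadpoles n W =
     {{0, i} | i. i \<in> {1..n} \<and> (\<forall>u \<in> star_vertices n. {i, u} \<in> star_edges n W \<longrightarrow> u = 0)}"

text \<open>
  Isolated triangles and bands are represented by their sets of non-center vertices. A band with
  \<open>r\<close> triangles is a component of \<open>({1..n}, W)\<close> with \<open>r\<close> edges.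
\<close>

definition isolated_triangles :: "nat \<Rightarrow> nat set set \<Rightarrow> nat set set" where
  "isolated_triangles n W = {S \<in> components {1..n} W. card (edges_within W S) = 1}"

definition bands :: "nat \<Rightarrow> nat set set \<Rightarrow> nat set set" where
  "bands n W = {S \<in> components {1..n} W. card (edges_within W S) \<ge> 2}"

definition center_term :: "nat \<Rightarrow> nat \<Rightarrow> real" where
  "center_term n k = 2 * real k / real n - real k"

definition AT :: "nat \<Rightarrow> nat \<Rightarrow> real" where
  "AT k r = real k * (real r + 2) / 3 - 2 * real r / 3"

definition IT :: "nat \<Rightarrow> real" where
  "IT k = real k - 1"

definition TP :: "nat \<Rightarrow> real" where
  "TP k = real k"

lemma fin_graph_partially_completed_star:
  assumes "partially_completed_star n W"
  shows "fin_graph (star_vertices n) (star_edges n W)"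
proof -
  have n: "n > 1" using assms by (simp add: partially_completed_star_def)
  have rim: "e \<subseteq> star_vertices n \<and> card e = 2" if "e \<in> rim_edges n" for e
  proof -
    from that obtain i where i: "i \<in> {1..n}" "e = {i, i mod n + 1}"
      by (auto simp: rim_edges_def)
    have "i \<noteq> i mod n + 1"
      using i n by (cases "i = n") auto
    moreover have "i mod n + 1 \<le> n"
      using n by (simp add: Suc_le_eq)
    ultimately show ?thesis using i by (auto simp: star_vertices_def)
  qed
  have "W \<subseteq> rim_edges n \<or> n = 2 \<and> W = {{1, 2}}"
    using assms by (auto simp: partially_completed_star_def)
  with rim show ?thesis
    by (auto simp: fin_graph_def star_edges_def star_vertices_def)
qed

end

theory Submission
  imports Defs
begin

text \<open>
  A partially completed star is a cone over a linear forest: the rim edges \<open>W\<close> miss an edge of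
  the cycle, so they form disjoint paths, and the center is joined to every rim vertex. (For
  \<open>n = 2\<close> the single edge \<open>{1, 2}\<close> is already a path.) As a forest has no triangles, the triangles
  of the cone correspond to the rim edges. Writing \<open>r\<^sub>v\<close> for the degree of \<open>v\<close> in the forest and \<open>k\<close>
  for its number of edges, a rim vertex has \<open>t\<^sub>v = r\<^sub>v\<close> and \<open>d\<^sub>v = r\<^sub>v + 1\<close>, while the center has
  \<open>t\<^sub>0 = k\<close> and \<open>d\<^sub>0 = n\<close>; this gives the bias of the center by the handshake lemma.
  A tadpole has \<open>r\<^sub>v = 0\<close>, and its only neighbour is the center, so its bias is \<open>k\<close>.

  The bias of the other rim vertices is summed over one path \<open>S\<close> with \<open>e \<ge> 1\<close> edges at a time
  (\<open>bias_component\<close>). Collecting the neighbour sums edge by edge, the total is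
  \[ k \sum_{v \in S} \frac{1}{1 + r_v} - \sum_{v \in S} r_v
     + \sum_{\{u,v\} \subseteq S} \Big(\frac{r_v}{1 + r_u} + \frac{r_u}{1 + r_v}\Big). \]
  A path has \<open>e + 1\<close> vertices (\<open>card_component\<close>), and \<open>1 / (1 + r)\<close> agrees with the affine function
  \<open>2 / 3 - r / 6\<close> at \<open>r = 1\<close> and \<open>r = 2\<close>, so the first sum is \<open>(e + 2) / 3\<close>; the second is \<open>2 e\<close>.
  An edge contributes \<open>4 / 3\<close> to the third sum, whether its ends have degrees \<open>1, 2\<close> or \<open>2, 2\<close>.
  Only in a path with a single edge are the degrees \<open>1, 1\<close>, and then the contribution is \<open>1\<close>.
  This is the whole difference between bands and isolated triangles (\<open>bias_band\<close>,
  \<open>bias_isolated_triangle\<close>).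

  Nonnegativity is seen by symmetrizing the defining double sum: in any finite graph,
  \[ \sum_v \Delta^T_v = \sum_{\{u,v\} \in E} (t_u - t_v) \Big(\frac{1}{d_v} - \frac{1}{d_u}\Big), \]
  which is nonnegative as soon as along each edge the end of larger degree is in at least as many
  triangles (\<open>sum_vertex_TFB_nonneg\<close>). On a rim edge this is clear, and on a spoke the center has
  at least the degree and at least the triangle count of the other end.
\<close>

section \<open>A criterion for the triangle friendship paradox\<close>

lemma adjacency_sym: "adjacency E u v = adjacency E v u"
  by (simp add: adjacency_def insert_commute)

text \<open>
  The indicator of \<open>d\<^sub>v \<noteq> 0\<close> in the definition is absorbed by division by zero, which makes both
  sides \<open>0\<close> at an isolated vertex.
\<close>

lemma vertex_TFB_eq_sum_differences:
  "vertex_TFB V E v = (\<Sum>u\<in>V. real (adjacency E v u) *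
     (real (triangles_at V E u) - real (triangles_at V E v)) / real (degree V E v))"
proof (cases "degree V E v = 0")
  case False
  have "(\<Sum>u\<in>V. real (adjacency E v u)) = real (degree V E v)"
    by (simp add: degree_def)
  then show ?thesis
    using False
    by (simp add: vertex_TFB_def right_diff_distrib sum_subtractf diff_divide_distrib
        sum_divide_distrib[symmetric] sum_distrib_right[symmetric])
qed (simp add: vertex_TFB_def)

text \<open>
  Adding the double sum to itself with the roles of \<open>u\<close> and \<open>v\<close> exchanged turns the summand into
  \<open>(t\<^sub>u - t\<^sub>v) (1 / d\<^sub>v - 1 / d\<^sub>u)\<close>. At equal degrees this vanishes, so the order of the triangle
  counts matters only along edges whose ends have different degrees.
\<close>

lemma sum_vertex_TFB_nonneg:
  assumes "\<And>u v. u \<in> V \<Longrightarrow> v \<in> V \<Longrightarrow> {u, v} \<in> E \<Longrightarrow> degree V E u < degree V E v \<Longrightarrow>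
      triangles_at V E u \<le> triangles_at V E v"
    and "\<And>u v. u \<in> V \<Longrightarrow> v \<in> V \<Longrightarrow> {u, v} \<in> E \<Longrightarrow> degree V E u \<noteq> 0"
  shows "0 \<le> (\<Sum>v\<in>V. vertex_TFB V E v)"
proof -
  let ?t = "\<lambda>v. real (triangles_at V E v)" and ?d = "\<lambda>v. real (degree V E v)"
  let ?A = "\<lambda>u v. real (adjacency E u v)"
  have eq: "(\<Sum>v\<in>V. vertex_TFB V E v) = (\<Sum>v\<in>V. \<Sum>u\<in>V. ?A v u * (?t u - ?t v) / ?d v)"
    by (simp add: vertex_TFB_eq_sum_differences)
  also have "\<dots> = (\<Sum>v\<in>V. \<Sum>u\<in>V. ?A v u * (?t v - ?t u) / ?d u)"
    by (subst sum.swap) (simp add: adjacency_sym)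
  finally have "2 * (\<Sum>v\<in>V. vertex_TFB V E v) =
      (\<Sum>v\<in>V. \<Sum>u\<in>V. ?A v u * (?t u - ?t v) / ?d v + ?A v u * (?t v - ?t u) / ?d u)"
    using eq by (simp add: sum.distrib)
  also have "\<dots> \<ge> 0"
  proof (intro sum_nonneg)
    fix v u assume uv: "v \<in> V" "u \<in> V"
    show "0 \<le> ?A v u * (?t u - ?t v) / ?d v + ?A v u * (?t v - ?t u) / ?d u"
    proof (cases "{v, u} \<in> E")
      case True
      then have True': "{u, v} \<in> E"
        by (simp add: insert_commute)
      have pos: "?d u > 0" "?d v > 0"
        using assms(2)[OF uv True] assms(2)[OF uv(2,1) True'] by auto
      have "0 \<le> (?t u - ?t v) * (1 / ?d v - 1 / ?d u)"
      proof (cases "degree V E u" "degree V E v" rule: linorder_cases)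
        case less
        have "1 / ?d v \<le> 1 / ?d u"
          using less pos by (intro divide_left_mono) auto
        then show ?thesis
          using assms(1)[OF uv(2,1) True' less] by (intro mult_nonpos_nonpos) auto
      next
        case greater
        then have "1 / ?d u \<le> 1 / ?d v"
          using pos by (intro divide_left_mono) auto
        then show ?thesis
          using assms(1)[OF uv True greater] by (intro mult_nonneg_nonneg) auto
      qed simp
      also have "\<dots> = (?t u - ?t v) / ?d v + (?t v - ?t u) / ?d u"
        using pos by (simp add: field_simps)
      finally show ?thesis
        using True by (simp add: adjacency_def)
    qed (simp add: adjacency_def)
  qed
  finally show ?thesis by simp
qed

section \<open>Components of a graph\<close>

lemma equiv_components:
  "equiv V {(u, v). u \<in> V \<and> v \<in> V \<and> (u, v) \<in> {(x, y). {x, y} \<in> E}\<^sup>*}"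
proof -
  have "sym ({(x, y). {x, y} \<in> E}\<^sup>*)"
    by (intro sym_rtrancl) (auto simp: sym_def insert_commute)
  then show ?thesis
    by (auto simp: equiv_def refl_on_def sym_def trans_def intro: rtrancl_trans)
qed

lemma component_subset: "S \<in> components V E \<Longrightarrow> S \<subseteq> V"
  by (auto simp: components_def quotient_def)

lemma Union_components: "\<Union> (components V E) = V"
  unfolding components_def by (rule Union_quotient[OF equiv_components])

lemma components_disjoint:
  "S \<in> components V E \<Longrightarrow> S' \<in> components V E \<Longrightarrow> S \<noteq> S' \<Longrightarrow> S \<inter> S' = {}"
  unfolding components_def using quotient_disj[OF equiv_components] by blast

lemma finite_components: "finite V \<Longrightarrow> finite (components V E)"
  by (rule finite_UnionD) (simp add: Union_components)

lemma component_nonempty: "S \<in> components V E \<Longrightarrow> S \<noteq> {}"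
  unfolding components_def by (rule in_quotient_imp_non_empty[OF equiv_components])

lemma component_closed:
  assumes "S \<in> components V E" "x \<in> S" "{x, y} \<in> E" "y \<in> V"
  shows "y \<in> S"
  using assms by (auto simp: components_def quotient_def intro: rtrancl_into_rtrancl)

text \<open>
  With \<open>component_closed\<close> this characterizes components as minimal nonempty sets closed under
  adjacency; components are identified in this way below, without recourse to walks.
\<close>

lemma component_minimal:
  assumes S: "S \<in> components V E" and C: "C \<subseteq> S" "C \<noteq> {}"
    and closed: "\<And>x y. x \<in> C \<Longrightarrow> {x, y} \<in> E \<Longrightarrow> y \<in> C"
  shows "C = S"
proof -
  obtain a where a: "a \<in> C" using C by blast
  have "y \<in> C" if "y \<in> S" for y
  proof -
    have "(a, y) \<in> {(x, y). {x, y} \<in> E}\<^sup>*"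
      using quotient_eq_iff[OF equiv_components, of S V E S a y] S a C that
      by (auto simp: components_def)
    then show ?thesis
      by (induction rule: rtrancl_induct) (use a closed in auto)
  qed
  with C show ?thesis by blast
qed

lemma sum_components:
  assumes "finite V"
  shows "(\<Sum>v\<in>V. f v) = (\<Sum>S\<in>components V E. \<Sum>v\<in>S. f v)"
proof -
  have "sum f (\<Union> (components V E)) = (sum \<circ> sum) f (components V E)"
    using assms component_subset[of _ V E] components_disjoint[of _ V E]
    by (intro sum.Union_disjoint) (auto intro: finite_subset)
  then show ?thesis
    by (simp add: Union_components)
qed

section \<open>Linear forests\<close>

lemma sum_of_bool_mult_eq:
  fixes h :: "'a \<Rightarrow> real"
  assumes "finite A"
  shows "(\<Sum>u\<in>A. of_bool (P \<and> u = a) * h u) = of_bool (P \<and> a \<in> A) * h a"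
proof -
  have "(\<Sum>u\<in>A. of_bool (P \<and> u = a) * h u) = (\<Sum>u\<in>A. if u = a then of_bool P * h a else 0)"
    by (rule sum.cong) auto
  then show ?thesis
    using assms by simp
qed

lemma sum_of_bool_mult:
  fixes h :: "'a \<Rightarrow> real"
  assumes "finite A"
  shows "(\<Sum>u\<in>A. of_bool (u \<in> B) * h u) = sum h (B \<inter> A)"
proof -
  have "(\<Sum>u\<in>A. of_bool (u \<in> B) * h u) = (\<Sum>u\<in>A. if u \<in> B then h u else 0)"
    by (rule sum.cong) auto
  then show ?thesis
    using assms by (simp add: sum.inter_restrict[symmetric] Int_commute)
qed

text \<open>
  A disjoint union of paths on \<open>V\<close>, each oriented from one end to the other: \<open>R\<close> consists of the
  vertices that have a successor, and \<open>s\<close> gives that successor. Injectivity says that no two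
  vertices share a successor; a set violating the last assumption would contain a directed cycle.
  The orientation lets the edges be indexed by \<open>R\<close>, so that sums over edges become sums over
  vertices. Values of \<open>s\<close> outside \<open>R\<close> are arbitrary.
\<close>

locale linear_forest =
  fixes V R :: "'a set" and s :: "'a \<Rightarrow> 'a"
  assumes finite_V: "finite V"
    and R_subset: "R \<subseteq> V"
    and s_in_V: "i \<in> R \<Longrightarrow> s i \<in> V"
    and inj_s: "inj_on s R"
    and no_cycle: "C \<subseteq> R \<Longrightarrow> s ` C \<subseteq> C \<Longrightarrow> C = {}"
begin

definition edges :: "'a set set" where
  "edges = (\<lambda>i. {i, s i}) ` R"

definition path_degree :: "'a \<Rightarrow> nat" where
  "path_degree v = of_bool (v \<in> R) + of_bool (v \<in> s ` R)"

lemma finite_R: "finite R"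
  using R_subset finite_V by (rule finite_subset)

lemma s_neq: "i \<in> R \<Longrightarrow> s i \<noteq> i"
  using no_cycle[of "{i}"] by auto

lemma no_2_cycle: "i \<in> R \<Longrightarrow> s i \<in> R \<Longrightarrow> i \<noteq> s (s i)"
  using no_cycle[of "{i, s i}"] by auto

lemma no_3_cycle: "i \<in> R \<Longrightarrow> s i \<in> R \<Longrightarrow> s (s i) \<in> R \<Longrightarrow> s (s (s i)) \<noteq> i"
  using no_cycle[of "{i, s i, s (s i)}"] by auto

lemma edges_iff: "{u, v} \<in> edges \<longleftrightarrow> u \<in> R \<and> v = s u \<or> v \<in> R \<and> u = s v"
  by (auto simp: edges_def doubleton_eq_iff)

lemma edges_in_V: "{u, v} \<in> edges \<Longrightarrow> u \<in> V \<and> v \<in> V"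
  using R_subset s_in_V by (auto simp: edges_iff)

text \<open>
  Two vertices give the same edge only if each is the successor of the other, a directed 2-cycle.
  For the same reason the two indicators in \<open>adjacency_edges\<close> are never both \<open>1\<close>.
\<close>

lemma inj_edge: "inj_on (\<lambda>i. {i, s i}) R"
  using no_2_cycle by (auto simp: inj_on_def doubleton_eq_iff)

lemma card_edges: "card edges = card R"
  unfolding edges_def by (rule card_image[OF inj_edge])

lemma adjacency_edges:
  "adjacency edges u v = of_bool (u \<in> R \<and> v = s u) + of_bool (v \<in> R \<and> u = s v)"
  using no_2_cycle by (auto simp: adjacency_def edges_iff)

text \<open>
  As each vertex has at most one successor and is the successor of at most one vertex, a triangle
  would have to be oriented cyclically.
\<close>

lemma no_triangle:
  assumes "{a, b} \<in> edges" "{b, d} \<in> edges" "{a, d} \<in> edges" "a \<noteq> b" "b \<noteq> d" "a \<noteq> d"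
  shows False
proof -
  have inj: "\<And>x y. x \<in> R \<Longrightarrow> y \<in> R \<Longrightarrow> s x = s y \<Longrightarrow> x = y"
    using inj_s by (simp add: inj_on_def)
  have "a \<in> R \<and> b = s a \<and> b \<in> R \<and> d = s b \<and> d \<in> R \<and> a = s d \<or>
      b \<in> R \<and> a = s b \<and> d \<in> R \<and> b = s d \<and> a \<in> R \<and> d = s a"
    using assms inj[of a b] inj[of b d] inj[of a d] by (auto simp: edges_iff)
  then show False
    using no_3_cycle[of a] no_3_cycle[of b] by auto
qed

lemma card_edges_at: "card {e \<in> edges. v \<in> e} = path_degree v"
proof -
  have "{e \<in> edges. v \<in> e} = (\<lambda>i. {i, s i}) ` {i \<in> R. i = v \<or> s i = v}"
    by (auto simp: edges_def)
  then have "card {e \<in> edges. v \<in> e} = card {i \<in> R. i = v \<or> s i = v}"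
    by (simp add: card_image inj_on_subset[OF inj_edge])
  also have "{i \<in> R. i = v \<or> s i = v} = {i \<in> R. i = v} \<union> {i \<in> R. s i = v}"
    by blast
  also have "card \<dots> = card {i \<in> R. i = v} + card {i \<in> R. s i = v}"
    using finite_R s_neq by (intro card_Un_disjoint) auto
  also have "{i \<in> R. i = v} = (if v \<in> R then {v} else {})"
    by auto
  also have "card {i \<in> R. s i = v} = of_bool (v \<in> s ` R)"
  proof (cases "v \<in> s ` R")
    case True
    then obtain j where "j \<in> R" "v = s j" by blast
    then have "{i \<in> R. s i = v} = {j}"
      using inj_s by (auto simp: inj_on_def)
    then show ?thesis using True by simp
  next
    case False
    then have none: "{i \<in> R. s i = v} = {}" by blast
    show ?thesis using False unfolding none by simp
  qed
  finally show ?thesis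
    by (simp add: path_degree_def)
qed

lemma sum_adjacency:
  assumes "v \<in> V"
  shows "(\<Sum>u\<in>V. adjacency edges v u) = path_degree v"
proof -
  have "(\<Sum>u\<in>V. adjacency edges v u) = card {u \<in> V. {v, u} \<in> edges}"
    using finite_V by (simp add: adjacency_def sum.inter_filter[symmetric] of_bool_def Int_def)
  also have "\<dots> = card ((\<lambda>u. {v, u}) ` {u \<in> V. {v, u} \<in> edges})"
    by (rule card_image[symmetric]) (auto simp: inj_on_def doubleton_eq_iff)
  also have "(\<lambda>u. {v, u}) ` {u \<in> V. {v, u} \<in> edges} = {e \<in> edges. v \<in> e}"
  proof (intro subset_antisym subsetI)
    fix e assume e: "e \<in> {e \<in> edges. v \<in> e}"
    then obtain u where "e = {v, u}"
      by (auto simp: edges_def)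
    with e show "e \<in> (\<lambda>u. {v, u}) ` {u \<in> V. {v, u} \<in> edges}"
      using edges_in_V by auto
  qed auto
  finally show ?thesis
    by (simp add: card_edges_at)
qed

lemma component_step:
  assumes "S \<in> components V edges" "i \<in> R"
  shows "s i \<in> S \<longleftrightarrow> i \<in> S"
  using assms component_closed[OF assms(1), of i "s i"] component_closed[OF assms(1), of "s i" i]
    R_subset s_in_V by (auto simp: edges_iff)

lemma component_eqI:
  assumes S: "S \<in> components V edges" and C: "C \<subseteq> S" "C \<noteq> {}"
    and forward: "\<And>i. i \<in> R \<Longrightarrow> i \<in> C \<Longrightarrow> s i \<in> C"
    and backward: "\<And>i. i \<in> R \<Longrightarrow> s i \<in> C \<Longrightarrow> i \<in> C"
  shows "S = C"
  using component_minimal[OF S C] forward backward by (auto simp: edges_iff)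

text \<open>
  All vertices of a component but its final one have a successor. A final vertex exists
  since a component in which every vertex has a successor would be closed under \<open>s\<close>; it is unique
  because the set of vertices from which a given final vertex \<open>p\<close> is reached by following
  successors is closed under adjacency, hence is the whole component.
\<close>

lemma card_component:
  assumes S: "S \<in> components V edges"
  shows "card S = card (R \<inter> S) + 1"
proof -
  have fin: "finite S"
    using component_subset[OF S] finite_V by (rule finite_subset)
  have "\<not> S \<subseteq> R"
    using no_cycle[of S] component_nonempty[OF S] component_step[OF S] by blast
  then obtain p where p: "p \<in> S" "p \<notin> R" by blast
  define F where "F = {(i, s i) | i. i \<in> R}"
  define C where "C = {x \<in> S. (x, p) \<in> F\<^sup>*}"
  have "S = C"
  proof (rule component_eqI[OF S])
    show "C \<subseteq> S" "C \<noteq> {}"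
      using p by (auto simp: C_def)
  next
    fix i assume i: "i \<in> R" "i \<in> C"
    then have "(i, p) \<in> F\<^sup>*" "i \<noteq> p"
      using p by (auto simp: C_def)
    then obtain y where "(i, y) \<in> F" "(y, p) \<in> F\<^sup>*"
      by (metis converse_rtranclE)
    then show "s i \<in> C"
      using i component_step[OF S] by (auto simp: C_def F_def)
  next
    fix i assume i: "i \<in> R" "s i \<in> C"
    then have "(i, s i) \<in> F" by (auto simp: F_def)
    then show "i \<in> C"
      using i component_step[OF S] by (auto simp: C_def intro: converse_rtrancl_into_rtrancl)
  qed
  moreover have "x = p" if "x \<in> C" "x \<notin> R" for x
    using that by (auto simp: C_def F_def elim: converse_rtranclE)
  ultimately have "S = insert p (R \<inter> S)"
    using p by blast
  then show ?thesis
    using fin p by (metis Int_iff One_nat_def add.right_neutral add_Suc_right card_insert_disjoint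
        finite_Int)
qed

lemma edges_within_component:
  assumes "S \<in> components V edges"
  shows "edges_within edges S = (\<lambda>i. {i, s i}) ` (R \<inter> S)"
  using component_step[OF assms] by (auto simp: edges_within_def edges_def)

lemma card_edges_within_component:
  assumes "S \<in> components V edges"
  shows "card (edges_within edges S) = card (R \<inter> S)"
  unfolding edges_within_component[OF assms]
  by (rule card_image) (rule inj_on_subset[OF inj_edge], simp)

lemma sum_card_edges_within:
  "(\<Sum>S\<in>components V edges. card (edges_within edges S)) = card R"
proof -
  have "card R = (\<Sum>v\<in>V. if v \<in> R then 1 else 0)"
    using R_subset finite_V by (simp add: sum.inter_restrict[symmetric] Int_absorb1)
  also have "\<dots> = (\<Sum>S\<in>components V edges. \<Sum>v\<in>S. if v \<in> R then 1 else 0)"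
    by (rule sum_components[OF finite_V])
  also have "\<dots> = (\<Sum>S\<in>components V edges. card (edges_within edges S))"
  proof (rule sum.cong[OF refl])
    fix S assume S: "S \<in> components V edges"
    then have "finite S"
      using component_subset[OF S] finite_V by (blast intro: finite_subset)
    then show "(\<Sum>v\<in>S. if v \<in> R then 1 else 0) = card (edges_within edges S)"
      by (simp add: card_edges_within_component[OF S] sum.inter_restrict[symmetric] Int_commute)
  qed
  finally show ?thesis ..
qed

text \<open>
  The handshake lemma for a union \<open>S\<close> of components.
\<close>

lemma sum_path_degree:
  assumes S: "S \<subseteq> V" and closed: "\<And>i. i \<in> R \<Longrightarrow> s i \<in> S \<longleftrightarrow> i \<in> S"
  shows "(\<Sum>v\<in>S. path_degree v) = 2 * card (R \<inter> S)"
proof -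
  have fin: "finite S"
    using S finite_V by (rule finite_subset)
  have "s ` R \<inter> S = s ` (R \<inter> S)"
    using closed by auto
  then have "card (s ` R \<inter> S) = card (R \<inter> S)"
    by (simp add: card_image inj_on_subset[OF inj_s])
  then show ?thesis
    using fin by (simp add: path_degree_def sum.distrib of_bool_def
        sum.inter_restrict[symmetric] Int_commute)
qed

text \<open>
  Each edge \<open>{i, s i}\<close> is counted once from either end. This replaces the neighbour sums of the
  biases by a sum over the edges, in which all terms turn out to be equal.
\<close>

lemma sum_adjacency_double_count:
  fixes f h :: "'a \<Rightarrow> real"
  assumes S: "S \<subseteq> V" and closed: "\<And>i. i \<in> R \<Longrightarrow> s i \<in> S \<longleftrightarrow> i \<in> S"
  shows "(\<Sum>v\<in>S. f v * (\<Sum>u\<in>V. real (adjacency edges v u) * h u)) =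
    (\<Sum>i\<in>R \<inter> S. f i * h (s i) + f (s i) * h i)"
proof -
  have fin: "finite S"
    using S finite_V by (rule finite_subset)
  have "(\<Sum>v\<in>S. f v * (\<Sum>u\<in>V. of_bool (v \<in> R \<and> u = s v) * h u)) =
      (\<Sum>v\<in>S. of_bool (v \<in> R) * (f v * h (s v)))"
    using finite_V s_in_V by (intro sum.cong) (auto simp: sum_of_bool_mult_eq)
  then have 1: "(\<Sum>v\<in>S. f v * (\<Sum>u\<in>V. of_bool (v \<in> R \<and> u = s v) * h u)) =
      (\<Sum>i\<in>R \<inter> S. f i * h (s i))"
    using sum_of_bool_mult[OF fin, of R] by simp
  have "(\<Sum>v\<in>S. f v * (\<Sum>u\<in>V. of_bool (u \<in> R \<and> v = s u) * h u)) =
      (\<Sum>v\<in>S. \<Sum>u\<in>V. of_bool (u \<in> R \<and> v = s u) * (f v * h u))"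
    by (simp add: sum_distrib_left mult_ac)
  also have "\<dots> = (\<Sum>u\<in>V. \<Sum>v\<in>S. of_bool (u \<in> R \<and> v = s u) * (f v * h u))"
    by (rule sum.swap)
  also have "\<dots> = (\<Sum>u\<in>V. of_bool (u \<in> R \<inter> S) * (f (s u) * h u))"
  proof (rule sum.cong[OF refl])
    fix u
    show "(\<Sum>v\<in>S. of_bool (u \<in> R \<and> v = s u) * (f v * h u)) = of_bool (u \<in> R \<inter> S) * (f (s u) * h u)"
      using sum_of_bool_mult_eq[OF fin, of "u \<in> R" "s u" "\<lambda>v. f v * h u"] closed[of u]
      by (cases "u \<in> R") auto
  qed
  also have "\<dots> = (\<Sum>i\<in>R \<inter> S \<inter> V. f (s i) * h i)"
    using finite_V by (rule sum_of_bool_mult)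
  also have "R \<inter> S \<inter> V = R \<inter> S"
    using S by blast
  finally show ?thesis
    using 1 by (simp add: adjacency_edges distrib_right distrib_left sum.distrib)
qed

lemma sum_components_by_edges:
  "(\<Sum>S\<in>components V edges. F S) =
    (\<Sum>S | S \<in> components V edges \<and> card (edges_within edges S) = 0. F S) +
    (\<Sum>S | S \<in> components V edges \<and> card (edges_within edges S) = 1. F S) +
    (\<Sum>S | S \<in> components V edges \<and> 2 \<le> card (edges_within edges S). F S)"
  for F :: "'a set \<Rightarrow> 'b :: comm_monoid_add"
proof -
  let ?A = "\<lambda>P. {S \<in> components V edges. P (card (edges_within edges S))}"
  have "components V edges = ?A (\<lambda>e. e = 0) \<union> ?A (\<lambda>e. e = 1) \<union> ?A (\<lambda>e. 2 \<le> e)"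
    by auto
  then have "(\<Sum>S\<in>components V edges. F S) =
      (\<Sum>S\<in>?A (\<lambda>e. e = 0) \<union> ?A (\<lambda>e. e = 1) \<union> ?A (\<lambda>e. 2 \<le> e). F S)"
    by (rule arg_cong)
  also have "\<dots> = (\<Sum>S\<in>?A (\<lambda>e. e = 0) \<union> ?A (\<lambda>e. e = 1). F S) + (\<Sum>S\<in>?A (\<lambda>e. 2 \<le> e). F S)"
    using finite_components[OF finite_V] by (intro sum.union_disjoint) auto
  also have "(\<Sum>S\<in>?A (\<lambda>e. e = 0) \<union> ?A (\<lambda>e. e = 1). F S) =
      (\<Sum>S\<in>?A (\<lambda>e. e = 0). F S) + (\<Sum>S\<in>?A (\<lambda>e. e = 1). F S)"
    using finite_components[OF finite_V] by (intro sum.union_disjoint) auto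
  finally show ?thesis .
qed

lemma edgeless_components:
  "{S \<in> components V edges. card (edges_within edges S) = 0} =
    (\<lambda>v. {v}) ` {v \<in> V. path_degree v = 0}"
proof (intro subset_antisym subsetI)
  fix S assume "S \<in> {S \<in> components V edges. card (edges_within edges S) = 0}"
  then have S: "S \<in> components V edges" and e: "card (R \<inter> S) = 0"
    by (auto simp: card_edges_within_component)
  then have empty: "R \<inter> S = {}"
    using finite_R by simp
  obtain v where v: "S = {v}"
    using card_component[OF S] e by (auto simp: card_1_singleton_iff)
  have "v \<notin> R" "v \<notin> s ` R"
    using empty component_step[OF S] unfolding v by blast+
  then show "S \<in> (\<lambda>v. {v}) ` {v \<in> V. path_degree v = 0}"
    using component_subset[OF S] v by (auto simp: path_degree_def)
next
  fix S assume "S \<in> (\<lambda>v. {v}) ` {v \<in> V. path_degree v = 0}"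
  then obtain v where v: "v \<in> V" "path_degree v = 0" "S = {v}" by blast
  then have isolated: "v \<notin> R" "v \<notin> s ` R"
    by (auto simp: path_degree_def)
  obtain T where T: "T \<in> components V edges" "v \<in> T"
    using v Union_components[of V edges] by blast
  have "T = S"
    unfolding v using T isolated by (intro component_eqI[OF T(1)]) auto
  then show "S \<in> {S \<in> components V edges. card (edges_within edges S) = 0}"
    using T isolated v by (auto simp: card_edges_within_component)
qed

end

section \<open>Cones over linear forests\<close>

locale linear_forest_cone = linear_forest +
  fixes c :: 'a
  assumes apex: "c \<notin> V"
    and V_nonempty: "V \<noteq> {}"
begin

definition cone_vertices :: "'a set" where
  "cone_vertices = insert c V"

definition cone_edges :: "'a set set" where
  "cone_edges = (\<lambda>i. {c, i}) ` V \<union> edges"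

abbreviation "k \<equiv> card R"

lemma cone_edges_iff:
  "{u, v} \<in> cone_edges \<longleftrightarrow> u = c \<and> v \<in> V \<or> v = c \<and> u \<in> V \<or> {u, v} \<in> edges"
  by (auto simp: cone_edges_def doubleton_eq_iff)

lemma adjacency_apex: "v \<in> V \<Longrightarrow> adjacency cone_edges c v = 1" "v \<in> V \<Longrightarrow> adjacency cone_edges v c = 1"
  by (auto simp: adjacency_def cone_edges_iff)

lemma adjacency_apex_self: "adjacency cone_edges c c = 0"
  using apex edges_in_V[of c c] cone_edges_iff[of c c] by (auto simp: adjacency_def)

lemma adjacency_base:
  "u \<in> V \<Longrightarrow> v \<in> V \<Longrightarrow> adjacency cone_edges u v = adjacency edges u v"
  using apex by (auto simp: adjacency_def cone_edges_iff)

lemma degree_apex: "degree cone_vertices cone_edges c = card V"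
  using apex finite_V
  by (simp add: degree_def cone_vertices_def adjacency_apex adjacency_apex_self)

lemma degree_base:
  assumes "v \<in> V"
  shows "degree cone_vertices cone_edges v = path_degree v + 1"
  using apex finite_V assms sum_adjacency[OF assms]
  by (simp add: degree_def cone_vertices_def adjacency_apex adjacency_base)

text \<open>
  A triangle through the apex is the cone over a forest edge, and by \<open>no_triangle\<close> there is no
  other one.
\<close>

lemma triangles_cone: "triangles cone_vertices cone_edges = insert c ` edges"
proof (intro subset_antisym subsetI)
  fix T assume "T \<in> triangles cone_vertices cone_edges"
  then have T: "T \<subseteq> insert c V" "card T = 3"
    "\<And>u v. u \<in> T \<Longrightarrow> v \<in> T \<Longrightarrow> u \<noteq> v \<Longrightarrow> {u, v} \<in> cone_edges"
    by (auto simp: triangles_def cone_vertices_def)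
  have base: "{u, v} \<in> edges" if "u \<in> T" "v \<in> T" "u \<noteq> v" "u \<noteq> c" "v \<noteq> c" for u v
    using T(3)[OF that(1-3)] that by (auto simp: cone_edges_iff)
  show "T \<in> insert c ` edges"
  proof (cases "c \<in> T")
    case True
    then have "card (T - {c}) = 2"
      using T(2) by simp
    then obtain a b where ab: "T - {c} = {a, b}" "a \<noteq> b"
      by (auto simp: card_2_iff)
    then have "{a, b} \<in> edges"
      by (intro base) auto
    moreover have "T = insert c {a, b}"
      using ab True by blast
    ultimately show ?thesis by blast
  next
    case False
    obtain x y z where "T = {x, y, z}" "x \<noteq> y" "y \<noteq> z" "x \<noteq> z"
      using T(2) by (auto simp: card_3_iff)
    then show ?thesis
      using no_triangle[of x y z] base False by auto
  qed
next
  fix T assume "T \<in> insert c ` edges"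
  then obtain i where i: "i \<in> R" "T = {c, i, s i}"
    by (auto simp: edges_def)
  have "i \<in> V" "s i \<in> V" "s i \<noteq> i" "i \<noteq> c" "s i \<noteq> c"
    using i R_subset s_in_V s_neq apex by auto
  then show "T \<in> triangles cone_vertices cone_edges"
    using i by (auto simp: triangles_def cone_vertices_def cone_edges_iff edges_iff)
qed

lemma apex_notin_edge: "e \<in> edges \<Longrightarrow> c \<notin> e"
  using apex R_subset s_in_V by (auto simp: edges_def)

lemma inj_insert_apex: "inj_on (insert c) edges"
  using apex_notin_edge by (auto simp: inj_on_def insert_ident)

lemma card_triangles_cone: "card (triangles cone_vertices cone_edges) = k"
  by (simp add: triangles_cone card_image[OF inj_insert_apex] card_edges)

lemma triangles_at_apex: "triangles_at cone_vertices cone_edges c = k"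
proof -
  have "{T \<in> triangles cone_vertices cone_edges. c \<in> T} = triangles cone_vertices cone_edges"
    by (auto simp: triangles_cone)
  then show ?thesis
    by (simp add: triangles_at_def card_triangles_cone)
qed

lemma triangles_at_base:
  assumes "v \<in> V"
  shows "triangles_at cone_vertices cone_edges v = path_degree v"
proof -
  have "{T \<in> triangles cone_vertices cone_edges. v \<in> T} = insert c ` {e \<in> edges. v \<in> e}"
    using assms apex by (auto simp: triangles_cone)
  then show ?thesis
    by (simp add: triangles_at_def card_image inj_on_subset[OF inj_insert_apex] card_edges_at)
qed

abbreviation "bias \<equiv> vertex_TFB cone_vertices cone_edges"

lemma bias_apex: "bias c = 2 * real k / real (card V) - real k"
proof -
  have "(\<Sum>u\<in>V. path_degree u) = 2 * k"
    using sum_path_degree[of V] R_subset s_in_V by (auto simp: Int_absorb2)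
  then have "(\<Sum>u\<in>V. real (path_degree u)) = 2 * real k"
    by (metis of_nat_sum of_nat_mult of_nat_numeral)
  moreover have "card V \<noteq> 0"
    using finite_V V_nonempty by simp
  moreover have "(\<Sum>u\<in>cone_vertices. real (adjacency cone_edges c u) *
      real (triangles_at cone_vertices cone_edges u)) = (\<Sum>u\<in>V. real (path_degree u))"
    using apex finite_V
    by (simp add: cone_vertices_def adjacency_apex adjacency_apex_self
        triangles_at_base[unfolded cone_vertices_def])
  ultimately show ?thesis
    by (simp add: vertex_TFB_def degree_apex triangles_at_apex)
qed

lemma bias_base:
  assumes "v \<in> V"
  shows "bias v = (real k + (\<Sum>u\<in>V. real (adjacency edges v u) * real (path_degree u))) /
    (1 + real (path_degree v)) - real (path_degree v)"
proof -
  have "(\<Sum>u\<in>cone_vertices. real (adjacency cone_edges v u) *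
      real (triangles_at cone_vertices cone_edges u)) =
      real k + (\<Sum>u\<in>V. real (adjacency cone_edges v u) *
      real (triangles_at cone_vertices cone_edges u))"
    using apex finite_V assms
    by (subst cone_vertices_def) (simp add: adjacency_apex triangles_at_apex)
  also have "(\<Sum>u\<in>V. real (adjacency cone_edges v u) *
      real (triangles_at cone_vertices cone_edges u)) =
      (\<Sum>u\<in>V. real (adjacency edges v u) * real (path_degree u))"
    using assms by (intro sum.cong) (auto simp: adjacency_base triangles_at_base)
  finally show ?thesis
    using assms by (simp add: vertex_TFB_def degree_base triangles_at_base)
qed

lemma bias_isolated:
  assumes "v \<in> V" "path_degree v = 0"
  shows "bias v = real k"
proof -
  have "\<forall>u\<in>V. adjacency edges v u = 0"
    using sum_adjacency[OF assms(1)] finite_V assms by simp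
  then show ?thesis
    using assms by (simp add: bias_base)
qed

text \<open>
  Every vertex of a component with an edge has degree 1 or 2 in the forest, so its inverse degree
  in the cone is given by an affine function of its forest degree. The sum of the inverse degrees
  then depends only on the number of edges. The sum over edges is left to be evaluated separately for components with
  one edge and with several.
\<close>

lemma bias_component:
  assumes S: "S \<in> components V edges" and e: "R \<inter> S \<noteq> {}"
  shows "(\<Sum>v\<in>S. bias v) = real k * (real (card (R \<inter> S)) + 2) / 3 - 2 * real (card (R \<inter> S)) +
    (\<Sum>i\<in>R \<inter> S. real (path_degree (s i)) / (1 + real (path_degree i)) +
      real (path_degree i) / (1 + real (path_degree (s i))))"
proof -
  let ?r = "\<lambda>v. real (path_degree v)"
  have SV: "S \<subseteq> V" by (rule component_subset[OF S])
  have deg: "(\<Sum>v\<in>S. ?r v) = 2 * real (card (R \<inter> S))"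
    using sum_path_degree[OF SV component_step[OF S]]
    by (metis of_nat_sum of_nat_mult of_nat_numeral)
  have pos: "path_degree v = 1 \<or> path_degree v = 2" if v: "v \<in> S" for v
  proof -
    have "path_degree v \<noteq> 0"
    proof
      assume "path_degree v = 0"
      then have "v \<notin> R" "v \<notin> s ` R"
        by (auto simp: path_degree_def)
      then have "S = {v}"
        using v by (intro component_eqI[OF S]) auto
      then show False
        using e \<open>v \<notin> R\<close> by auto
    qed
    then show ?thesis
      by (auto simp: path_degree_def)
  qed
  \<comment> \<open>the affine function that interpolates \<open>1 / (1 + r)\<close> at \<open>r = 1\<close> and \<open>r = 2\<close>\<close>
  have "(\<Sum>v\<in>S. 1 / (1 + ?r v)) = (\<Sum>v\<in>S. 2 / 3 - ?r v / 6)"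
  proof (rule sum.cong[OF refl])
    fix v assume "v \<in> S"
    from pos[OF this] show "1 / (1 + ?r v) = 2 / 3 - ?r v / 6" by auto
  qed
  also have "\<dots> = (real (card (R \<inter> S)) + 2) / 3"
    by (simp add: sum_subtractf sum_divide_distrib[symmetric] deg card_component[OF S] field_simps)
  finally have inv: "(\<Sum>v\<in>S. 1 / (1 + ?r v)) = (real (card (R \<inter> S)) + 2) / 3" .
  have "(\<Sum>v\<in>S. bias v) = (\<Sum>v\<in>S. real k * (1 / (1 + ?r v)) +
      1 / (1 + ?r v) * (\<Sum>u\<in>V. real (adjacency edges v u) * ?r u) - ?r v)"
    using SV by (intro sum.cong) (auto simp: bias_base add_divide_distrib)
  also have "\<dots> = real k * (\<Sum>v\<in>S. 1 / (1 + ?r v)) +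
      (\<Sum>v\<in>S. 1 / (1 + ?r v) * (\<Sum>u\<in>V. real (adjacency edges v u) * ?r u)) - (\<Sum>v\<in>S. ?r v)"
    by (simp only: sum.distrib sum_subtractf sum_distrib_left)
  also have "\<dots> = real k * ((real (card (R \<inter> S)) + 2) / 3) +
      (\<Sum>i\<in>R \<inter> S. 1 / (1 + ?r i) * ?r (s i) + 1 / (1 + ?r (s i)) * ?r i) - 2 * real (card (R \<inter> S))"
    unfolding inv deg by (subst sum_adjacency_double_count[OF SV component_step[OF S]]) simp_all
  finally show ?thesis by simp
qed

lemma bias_isolated_triangle:
  assumes S: "S \<in> components V edges" and e: "card (R \<inter> S) = 1"
  shows "(\<Sum>v\<in>S. bias v) = IT k"
proof -
  obtain i where i: "R \<inter> S = {i}"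
    using e by (auto simp: card_1_singleton_iff)
  then have iR: "i \<in> R" "i \<in> S" by blast+
  then have si: "s i \<in> S" by (simp add: component_step[OF S])
  have only_i: "j = i" if "j \<in> R" "j \<in> S" for j
    using i that by blast
  have "s i \<notin> R"
    using only_i[of "s i"] si s_neq[OF iR(1)] by blast
  moreover have "i \<notin> s ` R"
  proof
    assume "i \<in> s ` R"
    then obtain j where j: "j \<in> R" "i = s j" by blast
    then have "j = i"
      using iR only_i[of j] component_step[OF S j(1)] by simp
    then show False
      using j s_neq[of j] by simp
  qed
  ultimately have "path_degree i = 1" "path_degree (s i) = 1"
    using iR(1) by (simp_all add: path_degree_def)
  then show ?thesis
    using bias_component[OF S] by (simp add: i IT_def)
qed

text \<open>
  If both ends of an edge had degree 1, the edge would be the whole component. For the other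
  possible degrees the edge contributes \<open>1 / 3 + 2 / 2\<close> or \<open>2 / 3 + 2 / 3\<close>, the same value.
\<close>

lemma bias_band:
  assumes S: "S \<in> components V edges" and e: "card (R \<inter> S) \<ge> 2"
  shows "(\<Sum>v\<in>S. bias v) = AT k (card (R \<inter> S))"
proof -
  have "real (path_degree (s i)) / (1 + real (path_degree i)) +
      real (path_degree i) / (1 + real (path_degree (s i))) = 4 / 3" if i: "i \<in> R \<inter> S" for i
  proof -
    have "s i \<in> R \<or> i \<in> s ` R"
    proof (rule ccontr)
      assume *: "\<not> (s i \<in> R \<or> i \<in> s ` R)"
      have "S = {i, s i}"
      proof (rule component_eqI[OF S])
        show "{i, s i} \<subseteq> S"
          using i component_step[OF S] by blast
        show "s j \<in> {i, s i}" if "j \<in> R" "j \<in> {i, s i}" for j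
          using that * by blast
        show "j \<in> {i, s i}" if "j \<in> R" "s j \<in> {i, s i}" for j
          using that * i inj_onD[OF inj_s, of j i] by blast
      qed simp
      then have "R \<inter> S \<subseteq> {i}" using * by auto
      then have "card (R \<inter> S) \<le> card {i}"
        by (intro card_mono) auto
      then show False using e by simp
    qed
    then have "path_degree i = 1 \<and> path_degree (s i) = 2 \<or>
        path_degree i = 2 \<and> path_degree (s i) = 1 \<or> path_degree i = 2 \<and> path_degree (s i) = 2"
      using i by (auto simp add: path_degree_def of_bool_def)
    then show ?thesis by auto
  qed
  then have "(\<Sum>i\<in>R \<inter> S. real (path_degree (s i)) / (1 + real (path_degree i)) +
      real (path_degree i) / (1 + real (path_degree (s i)))) = (\<Sum>i\<in>R \<inter> S. 4 / 3)"
    by (rule sum.cong[OF refl])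
  moreover have "R \<inter> S \<noteq> {}" using e by auto
  ultimately show ?thesis
    using bias_component[OF S] by (simp add: AT_def)
qed

text \<open>
  Between base vertices, \<open>t\<^sub>v = d\<^sub>v - 1\<close> makes triangle counts and degrees ordered alike. A base
  vertex has degree at most \<open>|V|\<close>, the degree of the apex, and is in at most all \<open>k\<close> triangles,
  the triangle count of the apex.
\<close>

lemma sum_bias_nonneg: "0 \<le> (\<Sum>v\<in>cone_vertices. bias v)"
proof (rule sum_vertex_TFB_nonneg)
  have deg_pos: "card V > 0"
    using finite_V V_nonempty by (simp add: card_gt_0_iff)
  have path_degree_le: "path_degree v \<le> k" for v
  proof -
    have "path_degree v \<le> card edges"
      using finite_R by (subst card_edges_at[symmetric]) (auto simp: edges_def intro!: card_mono)
    then show ?thesis by (simp add: card_edges)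
  qed
  have path_degree_less: "path_degree v < card V" if "v \<in> V" for v
  proof -
    have "path_degree v \<le> (\<Sum>u\<in>V. of_bool (u \<noteq> v))"
      using s_neq[of v] by (subst sum_adjacency[OF that, symmetric], intro sum_mono)
        (auto simp: adjacency_def edges_iff)
    also have "\<dots> = card (V - {v})"
      using finite_V by (simp add: sum.inter_filter[symmetric] of_bool_def set_diff_eq Int_def)
    finally show ?thesis
      using that finite_V deg_pos by auto
  qed
  fix u v assume uv: "u \<in> cone_vertices" "v \<in> cone_vertices" "{u, v} \<in> cone_edges"
  then show "degree cone_vertices cone_edges u \<noteq> 0"
    using deg_pos by (auto simp: cone_vertices_def degree_base[unfolded cone_vertices_def]
        degree_apex[unfolded cone_vertices_def])
  assume le: "degree cone_vertices cone_edges u < degree cone_vertices cone_edges v"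
  show "triangles_at cone_vertices cone_edges u \<le> triangles_at cone_vertices cone_edges v"
  proof (cases "v = c")
    case True
    then show ?thesis
      using uv path_degree_le by (auto simp: cone_vertices_def triangles_at_apex[unfolded cone_vertices_def]
          triangles_at_base[unfolded cone_vertices_def])
  next
    case False
    then have v: "v \<in> V"
      using uv by (simp add: cone_vertices_def)
    then have "u \<noteq> c"
      using le path_degree_less[OF v] by (auto simp: degree_apex degree_base)
    then have "u \<in> V"
      using uv by (simp add: cone_vertices_def)
    then show ?thesis
      using le v by (simp add: degree_base triangles_at_base)
  qed
qed

lemma sum_bias_base:
  "(\<Sum>v\<in>V. bias v) =
    (\<Sum>S | S \<in> components V edges \<and> 2 \<le> card (edges_within edges S).
      AT k (card (edges_within edges S))) +
    real (card {S \<in> components V edges. card (edges_within edges S) = 1}) * IT k +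
    real (card {v \<in> V. path_degree v = 0}) * TP k"
proof -
  have "(\<Sum>S | S \<in> components V edges \<and> card (edges_within edges S) = 0. \<Sum>v\<in>S. bias v) =
      (\<Sum>v | v \<in> V \<and> path_degree v = 0. bias v)"
    unfolding edgeless_components by (simp add: sum.reindex)
  also have "\<dots> = (\<Sum>v | v \<in> V \<and> path_degree v = 0. TP k)"
    by (intro sum.cong) (auto simp: bias_isolated TP_def)
  finally have edgeless:
    "(\<Sum>S | S \<in> components V edges \<and> card (edges_within edges S) = 0. \<Sum>v\<in>S. bias v) =
      real (card {v \<in> V. path_degree v = 0}) * TP k"
    by simp
  have "(\<Sum>S | S \<in> components V edges \<and> card (edges_within edges S) = 1. \<Sum>v\<in>S. bias v) =
      (\<Sum>S | S \<in> components V edges \<and> card (edges_within edges S) = 1. IT k)"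
    by (intro sum.cong) (auto simp: card_edges_within_component bias_isolated_triangle)
  moreover have
    "(\<Sum>S | S \<in> components V edges \<and> 2 \<le> card (edges_within edges S). \<Sum>v\<in>S. bias v) =
      (\<Sum>S | S \<in> components V edges \<and> 2 \<le> card (edges_within edges S).
        AT k (card (edges_within edges S)))"
    by (intro sum.cong) (auto simp: card_edges_within_component bias_band)
  ultimately show ?thesis
    unfolding sum_components[OF finite_V, of _ edges] sum_components_by_edges edgeless by simp
qed

lemma only_neighbour_apex_iff:
  assumes "i \<in> V"
  shows "(\<forall>u\<in>cone_vertices. {i, u} \<in> cone_edges \<longrightarrow> u = c) \<longleftrightarrow> path_degree i = 0"
proof -
  have "path_degree i = 0 \<longleftrightarrow> (\<forall>u\<in>V. {i, u} \<notin> edges)"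
    using sum_adjacency[OF assms, symmetric] finite_V by (auto simp: adjacency_def)
  moreover have "{i, u} \<in> cone_edges \<longleftrightarrow> {i, u} \<in> edges" if "u \<in> V" for u
    using that assms apex by (auto simp: cone_edges_iff)
  ultimately show ?thesis
    using apex by (auto simp: cone_vertices_def)
qed

end

section \<open>Partially completed stars\<close>

text \<open>
  The successor on the cycle acts transitively on \<open>{1..n}\<close>.
\<close>

lemma cyclic_successor_closed:
  fixes n :: nat
  assumes "n > 0" "C \<subseteq> {1..n}" "C \<noteq> {}" "(\<lambda>i. i mod n + 1) ` C \<subseteq> C"
  shows "C = {1..n}"
proof -
  obtain x where x: "x \<in> C" using assms by blast
  then have x_bounds: "1 \<le> x" "x \<le> n" using assms by auto
  have orbit: "(x - 1 + j) mod n + 1 \<in> C" for j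
  proof (induction j)
    case 0
    then show ?case using x x_bounds by simp
  next
    case (Suc j)
    then have "((x - 1 + j) mod n + 1) mod n + 1 \<in> C"
      using assms(4) by blast
    then show ?case by (simp add: mod_Suc_eq)
  qed
  have "y \<in> C" if y: "y \<in> {1..n}" for y
  proof -
    \<comment> \<open>\<open>y - x\<close> steps lead from \<open>x\<close> to \<open>y\<close>; adding a full turn keeps the number of steps nonnegative\<close>
    have "x - 1 + (n - x + y) = n + (y - 1)"
      using y x_bounds by simp
    moreover have "(n + (y - 1)) mod n = y - 1"
      using y by (subst mod_add_self1) auto
    ultimately show ?thesis
      using orbit[of "n - x + y"] y by simp
  qed
  with assms(2) show ?thesis by blast
qed

lemma inj_on_cyclic_successor: "inj_on (\<lambda>i. i mod n + 1) {1..n}" for n :: nat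
proof -
  have "i mod n = (if i = n then 0 else i)" if "i \<in> {1..n}" for i
    using that by auto
  then show ?thesis
    by (auto simp: inj_on_def split: if_splits)
qed

text \<open>
  Each rim edge is labelled by its start in the cyclic orientation. A proper subset \<open>R\<close> of
  \<open>{1..n}\<close> contains no directed cycle, because such a cycle would visit all of \<open>{1..n}\<close>. For
  \<open>n = 2\<close> both labels name the same edge, so \<open>W\<close> is all of the rim; taking \<open>R = {1}\<close> still gives a
  proper subset.
\<close>

lemma rim_linear_forest:
  assumes "partially_completed_star n W"
  obtains R s where "linear_forest {1..n} R s" and "W = linear_forest.edges R s"
proof -
  let ?s = "\<lambda>i. i mod n + 1"
  have n: "n > 1" using assms by (simp add: partially_completed_star_def)
  have rim: "rim_edges n = (\<lambda>i. {i, ?s i}) ` {1..n}"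
    by (auto simp: rim_edges_def)
  have "\<exists>R. R \<subset> {1..n} \<and> W = (\<lambda>i. {i, ?s i}) ` R"
  proof (cases "W \<subset> rim_edges n")
    case True
    then have "W \<subseteq> (\<lambda>i. {i, ?s i}) ` {1..n}"
      by (simp only: rim psubset_imp_subset)
    then obtain R where R: "R \<subseteq> {1..n}" "W = (\<lambda>i. {i, ?s i}) ` R"
      unfolding subset_image_iff by blast
    have "R \<noteq> {1..n}"
      using True R(2) unfolding rim by blast
    with R show ?thesis by blast
  next
    case False
    then have "n = 2" "W = {{1, 2}}"
      using assms by (auto simp: partially_completed_star_def)
    moreover have "2 \<in> {1..2::nat}" "2 \<notin> {1::nat}" "{1} \<subseteq> {1..2::nat}"
      by simp_all
    then have "{1} \<subset> {1..2::nat}"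
      by blast
    moreover have "{{1, 2}} = (\<lambda>i. {i, i mod 2 + 1}) ` {1::nat}"
      by (simp add: numeral_2_eq_2)
    ultimately show ?thesis by metis
  qed
  then obtain R where R: "R \<subset> {1..n}" and W: "W = (\<lambda>i. {i, ?s i}) ` R" by blast
  have "linear_forest {1..n} R ?s"
  proof
    show "?s i \<in> {1..n}" for i
      using n by (simp add: Suc_le_eq)
    show "inj_on ?s R"
      using inj_on_cyclic_successor R by (blast intro: inj_on_subset)
    show "C = {}" if C: "C \<subseteq> R" "?s ` C \<subseteq> C" for C
    proof (rule ccontr)
      assume "C \<noteq> {}"
      then have "C = {1..n}"
        using C R n by (intro cyclic_successor_closed) auto
      then show False
        using C R by blast
    qed
    show "R \<subseteq> {1..n}"
      using R by blast
  qed simp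
  moreover from this have "W = linear_forest.edges R ?s"
    by (simp only: linear_forest.edges_def W)
  ultimately show ?thesis by (rule that)
qed

theorem theorem1:
  fixes n t kt m k :: nat
    and W :: "nat set set"
    and B :: "nat \<Rightarrow> nat set"
    and ks :: "nat \<Rightarrow> nat"
  assumes "partially_completed_star n W"
    and "t = card (tadpoles n W)"
    and "kt = card (isolated_triangles n W)"
    and "bij_betw B {1..m} (bands n W)"
    and "\<And>i. i \<in> {1..m} \<Longrightarrow> ks i = card (edges_within W (B i))"
    and "k = kt + (\<Sum>i=1..m. ks i)"
  shows "TFP_holds (star_vertices n) (star_edges n W) \<and>
    TFB (star_vertices n) (star_edges n W) =
      1 / (real n + 1) *
        (center_term n k + (\<Sum>i=1..m. AT k (ks i)) + real kt * IT k + real t * TP k) \<and>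
    card (triangles (star_vertices n) (star_edges n W)) = k \<and>
    vertex_TFB (star_vertices n) (star_edges n W) 0 = center_term n k \<and>
    (\<forall>i\<in>{1..m}. (\<Sum>v\<in>B i. vertex_TFB (star_vertices n) (star_edges n W) v) = AT k (ks i)) \<and>
    (\<forall>S\<in>isolated_triangles n W.
       (\<Sum>v\<in>S. vertex_TFB (star_vertices n) (star_edges n W) v) = IT k) \<and>
    (\<forall>i\<in>{1..n}. {0, i} \<in> tadpoles n W \<longrightarrow>
       vertex_TFB (star_vertices n) (star_edges n W) i = TP k)"
proof -
  obtain R s where forest: "linear_forest {1..n} R s" and W: "W = linear_forest.edges R s"
    using rim_linear_forest[OF assms(1)] .
  define V where "V = {1..n}"
  interpret linear_forest_cone V R s 0
    using forest assms(1)
    by (auto simp: V_def linear_forest_cone_def linear_forest_cone_axioms_def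
        partially_completed_star_def)
  have vertices: "star_vertices n = cone_vertices"
    unfolding star_vertices_def cone_vertices_def V_def[symmetric] by simp
  have edges: "star_edges n W = cone_edges"
    unfolding star_edges_def cone_edges_def V_def[symmetric] W by blast
  have card_V: "card V = n"
    by (simp add: V_def)
  have card_vertices: "card cone_vertices = n + 1"
    using apex finite_V card_V by (simp add: cone_vertices_def)
  have tadpoles: "tadpoles n W = (\<lambda>i. {0, i}) ` {i \<in> V. path_degree i = 0}"
    unfolding tadpoles_def vertices edges V_def[symmetric] using only_neighbour_apex_iff by blast
  have t: "t = card {i \<in> V. path_degree i = 0}"
    unfolding assms(2) tadpoles by (rule card_image) (auto simp: inj_on_def doubleton_eq_iff)
  have sum_bands: "(\<Sum>S\<in>bands n W. F (card (edges_within W S))) = (\<Sum>i=1..m. F (ks i))"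
    for F :: "nat \<Rightarrow> 'b :: comm_monoid_add"
    using sum.reindex_bij_betw[OF assms(4), of "\<lambda>S. F (card (edges_within W S))"] assms(5) by simp
  have "card R = (\<Sum>S\<in>components V edges. card (edges_within edges S))"
    by (rule sum_card_edges_within[symmetric])
  also have "\<dots> = card (isolated_triangles n W) + (\<Sum>S\<in>bands n W. card (edges_within W S))"
    unfolding sum_components_by_edges isolated_triangles_def bands_def W V_def[symmetric] by simp
  also have "\<dots> = k"
    using sum_bands[of "\<lambda>e. e"] assms(3,6) by simp
  finally have k: "card R = k" .
  have base: "(\<Sum>v\<in>V. bias v) = (\<Sum>i=1..m. AT k (ks i)) + real kt * IT k + real t * TP k"
    using sum_bias_base sum_bands[of "AT k"]
    by (simp only: bands_def isolated_triangles_def assms(3) t k W V_def[symmetric])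
  have center: "bias 0 = center_term n k"
    using bias_apex card_V by (simp add: center_term_def k)
  have total: "(\<Sum>v\<in>cone_vertices. bias v) =
      center_term n k + (\<Sum>i=1..m. AT k (ks i)) + real kt * IT k + real t * TP k"
    using base center apex finite_V by (simp add: cone_vertices_def)
  have "TFP_holds cone_vertices cone_edges"
    using sum_bias_nonneg by (simp add: TFP_holds_def TFB_def)
  moreover have "TFB cone_vertices cone_edges = 1 / (real n + 1) *
      (center_term n k + (\<Sum>i=1..m. AT k (ks i)) + real kt * IT k + real t * TP k)"
    unfolding TFB_def total card_vertices by (simp add: add.commute)
  moreover have "(\<Sum>v\<in>B i. bias v) = AT k (ks i)" if "i \<in> {1..m}" for i
  proof -
    have "B i \<in> bands n W"
      using assms(4) that by (auto simp: bij_betw_def)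
    then show ?thesis
      using bias_band[of "B i"] unfolding assms(5)[OF that] bands_def W V_def[symmetric]
      by (auto simp: card_edges_within_component k)
  qed
  moreover have "(\<Sum>v\<in>S. bias v) = IT k" if "S \<in> isolated_triangles n W" for S
    using bias_isolated_triangle[of S] that unfolding isolated_triangles_def W V_def[symmetric]
    by (auto simp: card_edges_within_component k)
  moreover have "bias i = TP k" if "i \<in> V" "{0, i} \<in> tadpoles n W" for i
    using bias_isolated[of i] that by (auto simp: tadpoles doubleton_eq_iff TP_def k)
  ultimately show ?thesis
    unfolding vertices edges V_def[symmetric] using center card_triangles_cone k by blast
qed

end
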